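(* For every $v\equiv 0 \pmod 6$ with $v\ge 18$, there exists a $2$-split decomposition of $K_v^{(3)}-I$ into tight $9$-cycles.
   Context: $K_v^{(3)}$ denotes the complete $3$-uniform hypergraph on $v$ vertices; for $3\mid v$, $K_v^{(3)}-I$ is obtained by deleting the edges of a $1$-factor $I$ (a set of $v/3$ pairwise disjoint triples covering all vertices). A (3-uniform tight) $k$-cycle is given by a cyclic sequence $v_1,\dots,v_k$ of $k$ distinct vertices, its edges being the triples $\{v_i,v_{i+1},v_{i+2}\}$ ($i=1,\dots,k$, indices mod $k$). A decomposition is a collection of cycles whose edge sets partition the edge set. For even $v$ with $3\mid v/2$, a $2$-split decomposition of $K_v^{(3)}-I$ into $k$-cycles is one where the vertex set is partitioned into two sets $V_1,V_2$ of size $v/2$, the $1$-factor is $I=I_1\cup I_2$ with $I_j$ a $1$-factor of $V_j$, and the collection of cycles consists of a $k$-cycle decomposition of $K^{(3)}[V_1]-I_1$, a $k$-cycle decomposition of $K^{(3)}[V_2]-I_2$, and a $k$-cycle decomposition of the hypergraph of all triples meeting both $V_1$ and $V_2$. *)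

theory Defs
  imports Main
begin

definition triples :: "'a set \<Rightarrow> 'a set set" where
  "triples V = {e. e \<subseteq> V \<and> card e = 3}"

definition one_factor :: "'a set \<Rightarrow> 'a set set \<Rightarrow> bool" where
  "one_factor V I \<longleftrightarrow> I \<subseteq> triples V \<and> \<Union>I = V \<and>
     (\<forall>e\<in>I. \<forall>f\<in>I. e \<noteq> f \<longrightarrow> e \<inter> f = {})"

text \<open>A tight k-cycle given by the cyclic sequence c of k distinct vertices.\<close>
definition tight_cycle :: "nat \<Rightarrow> 'a list \<Rightarrow> bool" where
  "tight_cycle k c \<longleftrightarrow> length c = k \<and> distinct c"

definition cycle_edges :: "'a list \<Rightarrow> 'a set set" where
  "cycle_edges c = (\<lambda>i. {c ! i, c ! ((i + 1) mod length c), c ! ((i + 2) mod length c)})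
                      ` {..<length c}"

definition cycle_decomposition :: "nat \<Rightarrow> 'a set set \<Rightarrow> 'a list set \<Rightarrow> bool" where
  "cycle_decomposition k H C \<longleftrightarrow>
     finite C \<and> (\<forall>c\<in>C. tight_cycle k c) \<and>
     (\<forall>c\<in>C. \<forall>d\<in>C. c \<noteq> d \<longrightarrow> cycle_edges c \<inter> cycle_edges d = {}) \<and>
     \<Union>(cycle_edges ` C) = H"

definition crossing_triples :: "'a set \<Rightarrow> 'a set \<Rightarrow> 'a set set" where
  "crossing_triples V1 V2 = {e \<in> triples (V1 \<union> V2). e \<inter> V1 \<noteq> {} \<and> e \<inter> V2 \<noteq> {}}"

definition two_split_decomposition :: "nat \<Rightarrow> 'a set \<Rightarrow> 'a set set \<Rightarrow> bool" where
  "two_split_decomposition k V I \<longleftrightarrow>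
     (\<exists>V1 V2 I1 I2 C1 C2 C3.
        V1 \<union> V2 = V \<and> V1 \<inter> V2 = {} \<and> 2 * card V1 = card V \<and> 2 * card V2 = card V \<and>
        one_factor V1 I1 \<and> one_factor V2 I2 \<and> I = I1 \<union> I2 \<and>
        cycle_decomposition k (triples V1 - I1) C1 \<and>
        cycle_decomposition k (triples V2 - I2) C2 \<and>
        cycle_decomposition k (crossing_triples V1 V2) C3)"

end

theory Submission
  imports Defs "HOL-Library.Multiset" "HOL-Library.Tree" "HOL-Library.List_Lexorder"
begin

text \<open>
  Let \<open>A\<close>, \<open>B\<close>, \<open>C\<close> be disjoint sets of sizes divisible by 3. The triples crossing between \<open>A\<close> and
  \<open>B \<union> C\<close> are those crossing between \<open>A\<close> and \<open>B\<close>, those crossing between \<open>A\<close> and \<open>C\<close>, and the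
  transversals of \<open>A\<close>, \<open>B\<close>, \<open>C\<close>; the triples inside \<open>A \<union> B\<close> are those inside \<open>A\<close>, those inside
  \<open>B\<close>, and the crossing ones. Splitting off parts of size 3, 6 or 9 therefore reduces everything to
  seven small hypergraphs: the transversals of three 3-sets, the crossing triples for sizes (6,6),
  (6,9), (9,9), and the complete hypergraph minus a 1-factor on 9, 12, 15 vertices. For these, an
  explicit decomposition that is invariant under a group acting freely on the edges is given by a
  few base cycles.
\<close>

section \<open>Decomposable hypergraphs\<close>

text \<open>The cycle length is fixed at 9 and the set of cycles is hidden, so the later gluing and
  transfer arguments concern edge sets only.\<close>

definition decomposable :: "'a set set \<Rightarrow> bool" where
  "decomposable H \<longleftrightarrow> (\<exists>C. cycle_decomposition 9 H C)"

lemma decomposable_empty: "decomposable {}"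
  unfolding decomposable_def cycle_decomposition_def by (rule exI[of _ "{}"]) simp

lemma decomposable_Un:
  assumes "decomposable H" "decomposable K" "H \<inter> K = {}"
  shows "decomposable (H \<union> K)"
proof -
  obtain C D where C: "cycle_decomposition 9 H C" and D: "cycle_decomposition 9 K D"
    using assms by (auto simp: decomposable_def)
  have 1: "cycle_edges c \<inter> cycle_edges d = {}" if "c \<in> C" "d \<in> D" for c d
    using that C D assms(3) unfolding cycle_decomposition_def by blast
  have "cycle_decomposition 9 (H \<union> K) (C \<union> D)"
    unfolding cycle_decomposition_def
  proof (intro conjI ballI impI)
    show "finite (C \<union> D)" using C D by (simp add: cycle_decomposition_def)
    show "tight_cycle 9 c" if "c \<in> C \<union> D" for c
      using that C D by (auto simp: cycle_decomposition_def)
    show "cycle_edges c \<inter> cycle_edges d = {}"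
      if cd: "c \<in> C \<union> D" "d \<in> C \<union> D" "c \<noteq> d" for c d
    proof -
      consider "c \<in> C" "d \<in> C" | "c \<in> D" "d \<in> D" | "c \<in> C" "d \<in> D" | "d \<in> C" "c \<in> D"
        using cd(1,2) by blast
      then show ?thesis
        using 1[of c d] 1[of d c] C D cd(3)
        by cases (simp_all add: cycle_decomposition_def Int_commute)
    qed
    show "\<Union> (cycle_edges ` (C \<union> D)) = H \<union> K"
      using C D by (simp add: cycle_decomposition_def image_Un)
  qed
  then show ?thesis by (auto simp: decomposable_def)
qed

section \<open>Relabelling the vertices of a decomposition\<close>

lemma cycle_edges_map: "cycle_edges (map f c) = (`) f ` cycle_edges c"
  unfolding cycle_edges_def image_image length_map
proof (rule image_cong[OF refl])
  fix i assume i: "i \<in> {..<length c}"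
  then have "j mod length c < length c" for j by (intro mod_less_divisor) auto
  then show "{map f c ! i, map f c ! ((i + 1) mod length c), map f c ! ((i + 2) mod length c)} =
      f ` {c ! i, c ! ((i + 1) mod length c), c ! ((i + 2) mod length c)}"
    using i by simp
qed

lemma set_subset_Union_cycle_edges: "set c \<subseteq> \<Union> (cycle_edges c)"
  by (force simp: cycle_edges_def in_set_conv_nth)

text \<open>Injectivity on the vertices lifts to injectivity on the edges, so relabelled cycles stay
  edge-disjoint. This carries the integer models over to arbitrary vertex sets.\<close>

lemma decomposable_image:
  assumes H: "decomposable H" and f: "inj_on f V" and HV: "\<Union> H \<subseteq> V"
  shows "decomposable ((`) f ` H)"
proof -
  obtain C where C: "cycle_decomposition 9 H C"
    using H by (auto simp: decomposable_def)
  have edges: "cycle_edges c \<subseteq> H" if "c \<in> C" for c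
    using C that by (auto simp: cycle_decomposition_def)
  \<comment> \<open>Each vertex of a cycle lies on one of its edges, so a bound on the vertices of
    \<open>H\<close> also bounds those of the cycles; distinctness of \<open>map f c\<close>
    follows.\<close>
  have set: "set c \<subseteq> V" if "c \<in> C" for c
    using set_subset_Union_cycle_edges[of c] edges[OF that] HV by blast
  have inj: "inj_on ((`) f) H"
    by (rule inj_on_image) (rule inj_on_subset[OF f HV])
  have "cycle_decomposition 9 ((`) f ` H) (map f ` C)"
    unfolding cycle_decomposition_def
  proof (intro conjI ballI impI)
    show "finite (map f ` C)" using C by (simp add: cycle_decomposition_def)
    show "tight_cycle 9 c" if "c \<in> map f ` C" for c
      using that C
      by (auto simp: cycle_decomposition_def tight_cycle_def distinct_map
          intro: inj_on_subset[OF f set])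
    show "cycle_edges c \<inter> cycle_edges d = {}"
      if cd: "c \<in> map f ` C" "d \<in> map f ` C" "c \<noteq> d" for c d
    proof -
      obtain c' d' where c': "c' \<in> C" "c = map f c'" and d': "d' \<in> C" "d = map f d'"
        using cd by auto
      have "c' \<noteq> d'" using cd(3) c' d' by blast
      then have "cycle_edges c' \<inter> cycle_edges d' = {}"
        using C c' d' unfolding cycle_decomposition_def by blast
      then show ?thesis
        using inj_on_image_Int[OF inj edges[OF c'(1)] edges[OF d'(1)]] c' d'
        by (simp add: cycle_edges_map)
    qed
    show "\<Union> (cycle_edges ` (map f ` C)) = (`) f ` H"
      using C by (auto simp: cycle_decomposition_def cycle_edges_map)
  qed
  then show ?thesis by (auto simp: decomposable_def)
qed

section \<open>Triples and one-factors\<close>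

lemma image_triples:
  assumes "inj_on f V"
  shows "(`) f ` triples V = triples (f ` V)"
proof
  show "(`) f ` triples V \<subseteq> triples (f ` V)"
    using assms by (auto simp: triples_def card_image inj_on_subset)
  show "triples (f ` V) \<subseteq> (`) f ` triples V"
  proof
    fix e assume e: "e \<in> triples (f ` V)"
    then obtain d where d: "d \<subseteq> V" "e = f ` d"
      by (auto simp: triples_def subset_image_iff)
    then have "card d = 3"
      using e card_image[OF inj_on_subset[OF assms d(1)]] by (simp add: triples_def)
    with d show "e \<in> (`) f ` triples V" by (auto simp: triples_def)
  qed
qed

lemma Union_triples: "\<Union> (triples V) \<subseteq> V"
  by (auto simp: triples_def)

lemma image_filter_triples:
  assumes f: "inj_on f V" and Q: "\<And>e. e \<in> triples V \<Longrightarrow> Q (f ` e) \<longleftrightarrow> P e"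
  shows "(`) f ` {e \<in> triples V. P e} = {e \<in> triples (f ` V). Q e}"
  using Q unfolding image_triples[OF f, symmetric] by auto

lemma one_factor_image:
  assumes I: "one_factor V I" and f: "inj_on f V"
  shows "one_factor (f ` V) ((`) f ` I)"
  unfolding one_factor_def
proof (intro conjI ballI impI)
  have sub: "e \<subseteq> V" if "e \<in> I" for e
    using I that by (auto simp: one_factor_def)
  show "(`) f ` I \<subseteq> triples (f ` V)"
    using I unfolding image_triples[OF f, symmetric] one_factor_def by auto
  show "\<Union> ((`) f ` I) = f ` V"
    using I by (auto simp: one_factor_def)
  fix e d assume "e \<in> (`) f ` I" "d \<in> (`) f ` I" and ne: "e \<noteq> d"
  then obtain e' d' where e': "e' \<in> I" "e = f ` e'" and d': "d' \<in> I" "d = f ` d'"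
    by auto
  have "e' \<noteq> d'" using ne e' d' by blast
  then have "e' \<inter> d' = {}"
    using I e' d' unfolding one_factor_def by blast
  then show "e \<inter> d = {}"
    using inj_on_image_Int[OF f sub[OF e'(1)] sub[OF d'(1)]] e' d' by simp
qed

lemma one_factor_Un:
  assumes "one_factor A I" "one_factor B J" "A \<inter> B = {}"
  shows "one_factor (A \<union> B) (I \<union> J)"
proof -
  have "e \<inter> f = {}" if "e \<in> I" "f \<in> J" for e f
    using that assms unfolding one_factor_def by blast
  then have "\<forall>e\<in>I \<union> J. \<forall>f\<in>I \<union> J. e \<noteq> f \<longrightarrow> e \<inter> f = {}"
    using assms(1,2) unfolding one_factor_def by (metis Un_iff inf_commute)
  moreover have "\<Union> (I \<union> J) = A \<union> B"
    using assms(1,2) by (simp add: one_factor_def Union_Un_distrib)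
  moreover have "I \<union> J \<subseteq> triples (A \<union> B)"
    using assms(1,2) by (auto simp: one_factor_def triples_def)
  ultimately show ?thesis by (simp add: one_factor_def)
qed

text \<open>Glues \<open>g\<close> to a bijection from \<open>Z\<close> onto \<open>C\<close>. This
  builds relabellings one part at a time, each part landing on a prescribed set.\<close>

lemma extend_injection:
  assumes g: "inj_on g U" and fin: "finite Z" "finite C" and card: "card Z = card C"
    and disj: "U \<inter> Z = {}" "g ` U \<inter> C = {}"
  obtains f where "inj_on f (U \<union> Z)" "\<And>X. X \<subseteq> U \<Longrightarrow> f ` X = g ` X" "f ` Z = C"
proof -
  obtain h where h: "bij_betw h Z C"
    using finite_same_card_bij[OF fin card] by blast
  define f where "f = (\<lambda>x. if x \<in> U then g x else h x)"
  have fU: "f x = g x" if "x \<in> U" for x using that by (simp add: f_def)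
  have fZ: "f x = h x" if "x \<in> Z" for x using that disj by (auto simp: f_def)
  have 1: "f ` X = g ` X" if "X \<subseteq> U" for X
    using that fU by (auto intro!: image_cong)
  have 2: "f ` Z = C"
    using fZ h by (auto simp: bij_betw_def)
  have "inj_on f U" using g fU by (simp cong: inj_on_cong)
  moreover have "inj_on f Z" using h fZ by (simp add: bij_betw_def cong: inj_on_cong)
  moreover have "f ` U \<inter> f ` Z = {}" using disj(2) 1[OF subset_refl] 2 by simp
  ultimately have "inj_on f (U \<union> Z)"
    unfolding inj_on_Un by blast
  then show ?thesis using that 1 2 by blast
qed

section \<open>Crossing triples and transversals\<close>

text \<open>For pairwise disjoint parts, this is the edge set of the complete tripartite 3-uniform
  hypergraph.\<close>

definition transversals :: "'a set \<Rightarrow> 'a set \<Rightarrow> 'a set \<Rightarrow> 'a set set" where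
  "transversals A B C = {{a, b, c} | a b c. a \<in> A \<and> b \<in> B \<and> c \<in> C}"

lemma transversals_rotate: "transversals A B C = transversals B C A"
proof -
  have sub: "transversals A B C \<subseteq> transversals B C A" for A B C :: "'a set"
  proof
    fix e assume "e \<in> transversals A B C"
    then obtain a b c where "e = {b, c, a}" "a \<in> A" "b \<in> B" "c \<in> C"
      unfolding transversals_def by (auto simp: insert_commute)
    then show "e \<in> transversals B C A" unfolding transversals_def by blast
  qed
  show ?thesis using sub[of A B C] sub[of B C A] sub[of C A B] by simp
qed

text \<open>A triple meeting three disjoint sets takes exactly one element from each. The form by
  intersections puts transversals and crossing triples in the same language, where their
  disjointness is plain.\<close>

lemma transversals_eq:
  assumes "A \<inter> B = {}" "A \<inter> C = {}" "B \<inter> C = {}"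
  shows "transversals A B C =
    {e \<in> triples (A \<union> B \<union> C). e \<inter> A \<noteq> {} \<and> e \<inter> B \<noteq> {} \<and> e \<inter> C \<noteq> {}}"
proof (intro equalityI subsetI)
  fix e assume "e \<in> transversals A B C"
  then obtain a b c where e: "e = {a, b, c}" "a \<in> A" "b \<in> B" "c \<in> C"
    by (auto simp: transversals_def)
  moreover have "a \<noteq> b" "a \<noteq> c" "b \<noteq> c" using e assms by auto
  ultimately show "e \<in> {e \<in> triples (A \<union> B \<union> C). e \<inter> A \<noteq> {} \<and> e \<inter> B \<noteq> {} \<and> e \<inter> C \<noteq> {}}"
    by (auto simp: triples_def)
next
  fix e assume "e \<in> {e \<in> triples (A \<union> B \<union> C). e \<inter> A \<noteq> {} \<and> e \<inter> B \<noteq> {} \<and> e \<inter> C \<noteq> {}}"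
  then obtain a b c where abc: "a \<in> A" "b \<in> B" "c \<in> C" "{a, b, c} \<subseteq> e" and e: "card e = 3"
    by (auto simp: triples_def)
  have "a \<noteq> b" "a \<noteq> c" "b \<noteq> c" using abc assms by auto
  then have "card {a, b, c} = card e" using e by simp
  then have "{a, b, c} = e"
    using abc(4) e by (intro card_subset_eq) (auto intro: card_ge_0_finite)
  then show "e \<in> transversals A B C" using abc by (auto simp: transversals_def)
qed

lemma crossing_triples_commute: "crossing_triples A B = crossing_triples B A"
  by (auto simp: crossing_triples_def Un_commute)

lemma crossing_triples_Un:
  assumes "A \<inter> B = {}" "A \<inter> C = {}" "B \<inter> C = {}"
  shows "crossing_triples A (B \<union> C) =
    crossing_triples A B \<union> crossing_triples A C \<union> transversals A B C"
proof (intro equalityI subsetI)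
  fix e assume "e \<in> crossing_triples A (B \<union> C)"
  then have e: "e \<subseteq> A \<union> B \<union> C" "card e = 3" "e \<inter> A \<noteq> {}" "e \<inter> (B \<union> C) \<noteq> {}"
    by (auto simp: crossing_triples_def triples_def)
  \<comment> \<open>A triple either misses \<open>C\<close>, misses \<open>B\<close>, or meets both;
    in the last case it meets all three parts.\<close>
  consider "e \<subseteq> A \<union> B" "e \<inter> B \<noteq> {}" | "e \<subseteq> A \<union> C" "e \<inter> C \<noteq> {}" | "e \<inter> B \<noteq> {}" "e \<inter> C \<noteq> {}"
    using e by blast
  then show "e \<in> crossing_triples A B \<union> crossing_triples A C \<union> transversals A B C"
    using e by cases (simp_all add: transversals_eq[OF assms] crossing_triples_def triples_def)
next
  fix e assume "e \<in> crossing_triples A B \<union> crossing_triples A C \<union> transversals A B C"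
  then have "e \<subseteq> A \<union> (B \<union> C) \<and> card e = 3 \<and> e \<inter> A \<noteq> {} \<and> e \<inter> (B \<union> C) \<noteq> {}"
    unfolding transversals_eq[OF assms] crossing_triples_def triples_def by (elim UnE) auto
  then show "e \<in> crossing_triples A (B \<union> C)"
    by (simp add: crossing_triples_def triples_def)
qed

lemma decomposable_crossing_Un:
  assumes "A \<inter> B = {}" "A \<inter> C = {}" "B \<inter> C = {}"
    and "decomposable (crossing_triples A B)" "decomposable (crossing_triples A C)"
    and "decomposable (transversals A B C)"
  shows "decomposable (crossing_triples A (B \<union> C))"
  unfolding crossing_triples_Un[OF assms(1-3)]
proof (intro decomposable_Un assms(4-6))
  show "crossing_triples A B \<inter> crossing_triples A C = {}"
    using assms(1-3) unfolding crossing_triples_def triples_def by blast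
  show "(crossing_triples A B \<union> crossing_triples A C) \<inter> transversals A B C = {}"
    using assms(1-3) unfolding transversals_eq[OF assms(1-3)] crossing_triples_def triples_def
    by blast
qed

section \<open>Explicit decompositions of the small hypergraphs\<close>

definition cyclic_triples :: "int list \<Rightarrow> int list list" where
  "cyclic_triples c = map2 (\<lambda>a (b, d). sort [a, b, d]) c (zip (rotate1 c) (rotate1 (rotate1 c)))"

definition increasing_triples :: "int \<Rightarrow> int list list" where
  "increasing_triples n =
     concat (map (\<lambda>a. concat (map (\<lambda>b. map (\<lambda>c. [a, b, c]) [b+1..n-1]) [a+1..n-1])) [0..n-1])"

fun tree_insert :: "'a::linorder \<Rightarrow> 'a tree \<Rightarrow> 'a tree" where
  "tree_insert x Leaf = Node Leaf x Leaf"
| "tree_insert x (Node l y r) =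
     (if x < y then Node (tree_insert x l) y r else Node l y (tree_insert x r))"

text \<open>Insertion sort, the default implementation of sorting, is too slow for the evaluations below.\<close>

definition tree_sort :: "'a::linorder list \<Rightarrow> 'a list" where
  "tree_sort xs = inorder (fold tree_insert xs Leaf)"

text \<open>Edges are represented by their sorted lists. \<open>increasing_triples\<close> runs in
  lexicographic order, so one equality of lists tests at once that every wanted edge occurs, that no
  other does, and that none occurs twice.\<close>

definition is_decomposition :: "int \<Rightarrow> (int set \<Rightarrow> bool) \<Rightarrow> int list list \<Rightarrow> bool" where
  "is_decomposition n P cs \<longleftrightarrow> list_all (\<lambda>c. length c = 9 \<and> distinct c) cs \<and>
     tree_sort (concat (map cyclic_triples cs)) = filter (\<lambda>t. P (set t)) (increasing_triples n)"

lemma mset_tree_sort: "mset (tree_sort xs) = mset xs"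
proof -
  have ins: "mset (inorder (tree_insert x t)) = add_mset x (mset (inorder t))" for x :: 'a and t
    by (induction t) auto
  have "mset (inorder (fold tree_insert xs t)) = mset xs + mset (inorder t)" for t
    by (induction xs arbitrary: t) (auto simp: ins)
  then show ?thesis by (simp add: tree_sort_def)
qed

lemma set_cyclic_triples: "set ` set (cyclic_triples c) = cycle_edges c"
proof -
  \<comment> \<open>The third entry of each triple comes from the list rotated twice, and this is
    its index computation.\<close>
  have rot: "rotate1 c ! (Suc i mod length c) = c ! (Suc (Suc i) mod length c)" if "i < length c" for i
  proof -
    have "Suc i mod length c < length c" using that by (intro mod_less_divisor) auto
    then show ?thesis using that by (simp add: nth_rotate1 mod_Suc_eq)
  qed
  have "cyclic_triples c =
    map (\<lambda>i. sort [c ! i, c ! ((i + 1) mod length c), c ! ((i + 2) mod length c)]) [0..<length c]"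
    by (rule nth_equalityI)
      (auto simp: cyclic_triples_def nth_rotate1 rot simp del: sort_key_simps)
  then have "set ` set (cyclic_triples c) =
    (\<lambda>i. set (sort [c ! i, c ! ((i + 1) mod length c), c ! ((i + 2) mod length c)])) ` {..<length c}"
    by (simp only: set_map image_image set_upt atLeast0LessThan)
  then show ?thesis by (simp only: cycle_edges_def set_sort list.set)
qed

lemma set_increasing_triples:
  "set (increasing_triples n) = {[a, b, c] | a b c. 0 \<le> a \<and> a < b \<and> b < c \<and> c < n}"
proof (intro equalityI subsetI)
  fix t assume "t \<in> {[a, b, c] | a b c. 0 \<le> a \<and> a < b \<and> b < c \<and> c < n}"
  then obtain a b c where t: "t = [a, b, c]" "0 \<le> a" "a < b" "b < c" "c < n" by blast
  then show "t \<in> set (increasing_triples n)" by (simp add: increasing_triples_def image_iff)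
qed (auto simp: increasing_triples_def)

lemma sorted_increasing_triples:
  "t \<in> set (increasing_triples n) \<Longrightarrow> sorted t \<and> distinct t"
  by (auto simp: set_increasing_triples)

text \<open>The first and second entries can be read off a triple, so the blocks for different
  values are disjoint; fact \<open>1\<close> applies at both levels of nesting.\<close>

lemma distinct_increasing_triples: "distinct (increasing_triples n)"
proof -
  have 1: "distinct (concat (map F xs))"
    if "distinct xs" "\<And>x. distinct (F x)" "\<And>x y t. t \<in> set (F x) \<Longrightarrow> t \<in> set (F y) \<Longrightarrow> x = y"
    for F :: "int \<Rightarrow> int list list" and xs
    using that(1)
  proof (induction xs)
    case (Cons x xs)
    have "set (F x) \<inter> set (F y) = {}" if "y \<in> set xs" for y
      using \<open>\<And>x y t. t \<in> set (F x) \<Longrightarrow> t \<in> set (F y) \<Longrightarrow> x = y\<close>[of _ x y] Cons.prems that by auto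
    with Cons that(2) show ?case by auto
  qed simp
  show ?thesis
    unfolding increasing_triples_def
    by (intro 1) (auto simp: distinct_map inj_on_def)
qed

lemma triples_eq_increasing: "set ` set (increasing_triples n) = triples {0..<n}"
proof (intro equalityI subsetI)
  fix e assume "e \<in> set ` set (increasing_triples n)"
  then show "e \<in> triples {0..<n}"
    by (auto simp: set_increasing_triples triples_def)
next
  fix e assume e: "e \<in> triples {0..<n}"
  define t where "t = sorted_list_of_set e"
  have fin: "finite e" using e by (auto simp: triples_def intro: card_ge_0_finite)
  then have t: "set t = e" "sorted t" "distinct t" "length t = 3"
    using e by (auto simp: t_def triples_def)
  then obtain a b c where abc: "t = [a, b, c]"
    by (auto simp: numeral_3_eq_3 length_Suc_conv)
  have "t \<in> set (increasing_triples n)"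
    using t e unfolding set_increasing_triples abc by (auto simp: triples_def)
  with t(1) show "e \<in> set ` set (increasing_triples n)" by blast
qed

text \<open>Soundness of the check. Sorting preserves multisets, so the edge list is a rearrangement
  of a list without repetitions and is itself without repetitions.\<close>

lemma is_decomposition_decomposable:
  assumes "is_decomposition n P cs"
  shows "decomposable {e \<in> triples {0..<n}. P e}"
proof -
  let ?es = "concat (map cyclic_triples cs)" and ?ts = "filter (\<lambda>t. P (set t)) (increasing_triples n)"
  have mset: "mset ?es = mset ?ts"
    using assms mset_tree_sort[of ?es] by (simp add: is_decomposition_def)
  have set: "set ?es = set ?ts" using mset by (rule mset_eq_setD)
  have distinct: "distinct ?es"
    using mset_eq_imp_distinct_iff[OF mset] distinct_increasing_triples by simp
  \<comment> \<open>A sorted list without repetitions is determined by its set, so disjointness of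
    edge lists passes to disjointness of edges as sets.\<close>
  have inj: "inj_on set (set ?es)"
    unfolding set using sorted_increasing_triples
    by (auto intro!: inj_onI intro: sorted_distinct_set_unique)
  have "cycle_decomposition 9 {e \<in> triples {0..<n}. P e} (set cs)"
    unfolding cycle_decomposition_def
  proof (intro conjI ballI impI)
    show "finite (set cs)" by simp
    show "tight_cycle 9 c" if "c \<in> set cs" for c
      using assms that by (auto simp: is_decomposition_def tight_cycle_def list_all_iff)
    show "cycle_edges c \<inter> cycle_edges d = {}" if cd: "c \<in> set cs" "d \<in> set cs" "c \<noteq> d" for c d
    proof -
      have "set (cyclic_triples c) \<inter> set (cyclic_triples d) = {}"
        using distinct cd by (induction cs) auto
      then show ?thesis
        using inj_on_image_Int[OF inj, of "set (cyclic_triples c)" "set (cyclic_triples d)"] cd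
        by (auto simp: set_cyclic_triples)
    qed
    have "\<Union> (cycle_edges ` set cs) = set ` set ?es"
      by (auto simp: set_cyclic_triples[symmetric])
    also have "\<dots> = {e \<in> triples {0..<n}. P e}"
      unfolding set triples_eq_increasing[symmetric] by auto
    finally show "\<Union> (cycle_edges ` set cs) = {e \<in> triples {0..<n}. P e}" .
  qed
  then show ?thesis by (auto simp: decomposable_def)
qed

text \<open>With \<open>s = n\<close> this is the full orbit of the base cycles under the cyclic
  group of order \<open>n\<close>. A smaller \<open>s\<close> serves base cycles that translation by
  \<open>s\<close> merely rotates.\<close>

definition translates :: "int \<Rightarrow> int \<Rightarrow> int list list \<Rightarrow> int list list" where
  "translates n s cs = concat (map (\<lambda>t. map (map (\<lambda>x. (x + t) mod n)) cs) [0..s-1])"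

text \<open>The parts are the residue classes mod 3. The three cycles list the multiples of 1, 4 and
  7 mod 9; these multipliers are 1 mod 3, so consecutive residues run 0, 1, 2 cyclically and every
  edge is a transversal.\<close>

lemma transversals_3_3_3:
  "is_decomposition 9 (\<lambda>e. (\<exists>x\<in>e. x mod 3 = 0) \<and> (\<exists>x\<in>e. x mod 3 = 1) \<and> (\<exists>x\<in>e. x mod 3 = 2))
    [[0, 1, 2, 3, 4, 5, 6, 7, 8], [0, 4, 8, 3, 7, 2, 6, 1, 5], [0, 7, 5, 3, 1, 8, 6, 4, 2]]"
  by code_simp

text \<open>A triple fixed by a nonzero translation mod \<open>n\<close> is a coset of the subgroup
  of order 3, that is, a residue class mod \<open>n / 3\<close>. Deleting these classes leaves a
  free action. Here 84 - 3 = 81 edges make nine cycles, a single orbit.\<close>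

lemma complete_minus_factor_9:
  "is_decomposition 9 (\<lambda>e. \<exists>x\<in>e. \<exists>y\<in>e. x mod 3 \<noteq> y mod 3)
    (translates 9 9 [[4, 0, 1, 2, 8, 6, 3, 7, 5]])"
  by code_simp

text \<open>There are 220 - 4 = 216 edges, hence 24 cycles in two orbits of length 12.\<close>

lemma complete_minus_factor_12:
  "is_decomposition 12 (\<lambda>e. \<exists>x\<in>e. \<exists>y\<in>e. x mod 4 \<noteq> y mod 4)
    (translates 12 12 [[5, 7, 0, 4, 2, 10, 1, 3, 6], [3, 9, 6, 7, 0, 8, 5, 4, 11]])"
  by code_simp

text \<open>Translation by a third of the modulus preserves the base cycles that have a short orbit.\<close>

lemma complete_minus_factor_15:
  "is_decomposition 15 (\<lambda>e. \<exists>x\<in>e. \<exists>y\<in>e. x mod 5 \<noteq> y mod 5)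
    (translates 15 5 [[1, 0, 13, 11, 10, 8, 6, 5, 3]] @
     translates 15 15 [[0, 3, 5, 8, 11, 7, 10, 2, 9], [1, 9, 0, 14, 6, 8, 7, 3, 12],
       [7, 12, 5, 1, 14, 9, 10, 0, 4]])"
  by code_simp

text \<open>The parts are the even and the odd residues, so every translation preserves crossing.
  The cosets of the subgroup of order 3 have constant parity, so the action on crossing triples is
  free. The 180 triples need 20 = 2 * 4 + 12 cycles.\<close>

lemma crossing_6_6:
  "is_decomposition 12 (\<lambda>e. (\<exists>x\<in>e. even x) \<and> (\<exists>x\<in>e. odd x))
    (translates 12 4 [[6, 11, 9, 10, 3, 1, 2, 7, 5], [11, 5, 8, 3, 9, 0, 7, 1, 4]] @
     translates 12 12 [[11, 9, 4, 1, 2, 6, 7, 3, 0]])"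
  by code_simp

text \<open>The parity model again: 648 crossing triples need 72 cycles, four full orbits of length
  18.\<close>

lemma crossing_9_9:
  "is_decomposition 18 (\<lambda>e. (\<exists>x\<in>e. even x) \<and> (\<exists>x\<in>e. odd x))
    (translates 18 18 [[12, 5, 8, 1, 0, 15, 3, 10, 11], [0, 15, 16, 2, 9, 12, 4, 17, 6],
       [3, 16, 12, 17, 10, 8, 11, 13, 4], [2, 16, 11, 10, 1, 7, 12, 9, 17]])"
  by code_simp

text \<open>
  Here the symmetry group is the square of the cyclic group of order 3: its factors act on
  \<open>{0, 1, 2}\<close> and \<open>{3, 4, 5}\<close> respectively, and it acts regularly on \<open>{6, \<dots>, 14}\<close>, where
  \<open>6 + 3 * i + j\<close> stands for \<open>(i, j)\<close>. The first base cycle is preserved by the diagonal.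
\<close>

definition shift_6_9 :: "int \<Rightarrow> int \<Rightarrow> int \<Rightarrow> int" where
  "shift_6_9 s t x = (if x < 3 then (x + s) mod 3 else if x < 6 then 3 + (x + t) mod 3
     else 6 + 3 * ((x div 3 - 2 + s) mod 3) + (x + t) mod 3)"

text \<open>There are 455 - 20 - 84 = 351 triples, hence 39 cycles. The maps
  \<open>shift_6_9 s 0\<close> represent the cosets of the diagonal and give an orbit of length 3;
  the other four base cycles have full orbits of length 9.\<close>

lemma crossing_6_9:
  "is_decomposition 15 (\<lambda>e. (\<exists>x\<in>e. x < 6) \<and> (\<exists>x\<in>e. \<not> x < 6))
    (map (\<lambda>s. map (shift_6_9 s 0) [6, 9, 4, 14, 8, 3, 10, 13, 5]) [0, 1, 2] @
     concat (map (\<lambda>(s, t). map (map (shift_6_9 s t))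
       [[8, 2, 5, 10, 4, 3, 11, 6, 0], [12, 13, 1, 3, 7, 11, 4, 9, 0],
        [2, 14, 8, 5, 0, 7, 12, 1, 11], [9, 11, 3, 12, 10, 2, 8, 1, 5]])
       [(0, 0), (0, 1), (0, 2), (1, 0), (1, 1), (1, 2), (2, 0), (2, 1), (2, 2)]))"
  by code_simp

section \<open>Transfer to arbitrary vertex sets\<close>

text \<open>The part sizes of the model are stated as lengths of filtered lists so that they can be
  evaluated. The relabelling sends the vertices satisfying \<open>p\<close> onto \<open>A\<close>
  and the others onto \<open>B\<close>.\<close>

lemma decomposable_crossing_transfer:
  fixes n :: int and A B :: "'a set"
  assumes dec: "decomposable {e \<in> triples {0..<n}. (\<exists>x\<in>e. p x) \<and> (\<exists>x\<in>e. \<not> p x)}"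
    and fin: "finite A" "finite B" and disj: "A \<inter> B = {}"
    and card: "length (filter p [0..n-1]) = card A" "length (filter (\<lambda>x. \<not> p x) [0..n-1]) = card B"
  shows "decomposable (crossing_triples A B)"
proof -
  define X Y where "X = {x \<in> {0..<n}. p x}" and "Y = {x \<in> {0..<n}. \<not> p x}"
  have sets: "X = set (filter p [0..n-1])" "Y = set (filter (\<lambda>x. \<not> p x) [0..n-1])"
    by (auto simp: X_def Y_def)
  then have cX: "card X = card A" and cY: "card Y = card B"
    using card by (simp_all only: distinct_card[OF distinct_filter[OF distinct_upto]])
  have XY: "{0..<n} = X \<union> Y" "X \<inter> Y = {}" by (auto simp: X_def Y_def)
  have fin': "finite X" "finite Y" by (simp_all only: sets finite_set)
  obtain g where g: "bij_betw g X A"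
    using finite_same_card_bij[OF fin'(1) fin(1) cX] by blast
  obtain f where f: "inj_on f (X \<union> Y)" "\<And>Z. Z \<subseteq> X \<Longrightarrow> f ` Z = g ` Z" "f ` Y = B"
    using extend_injection[of g X Y B] g XY fin fin' cY disj by (auto simp: bij_betw_def)
  have fX: "f ` X = A" using f(2)[of X] g by (simp add: bij_betw_def)
  have eq: "{e \<in> triples {0..<n}. (\<exists>x\<in>e. p x) \<and> (\<exists>x\<in>e. \<not> p x)} =
      {e \<in> triples (X \<union> Y). e \<inter> X \<noteq> {} \<and> e \<inter> Y \<noteq> {}}"
    unfolding XY(1)[symmetric] X_def Y_def triples_def by blast
  have image: "(`) f ` {e \<in> triples (X \<union> Y). e \<inter> X \<noteq> {} \<and> e \<inter> Y \<noteq> {}} = crossing_triples A B"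
    unfolding crossing_triples_def fX[symmetric] f(3)[symmetric] image_Un[symmetric]
  proof (rule image_filter_triples[OF f(1)])
    fix e assume "e \<in> triples (X \<union> Y)"
    then have "e \<subseteq> X \<union> Y" by (simp add: triples_def)
    then have "f ` e \<inter> f ` X = f ` (e \<inter> X)" "f ` e \<inter> f ` Y = f ` (e \<inter> Y)"
      using inj_on_image_Int[OF f(1), of e] by auto
    then show "(f ` e \<inter> f ` X \<noteq> {} \<and> f ` e \<inter> f ` Y \<noteq> {}) \<longleftrightarrow> (e \<inter> X \<noteq> {} \<and> e \<inter> Y \<noteq> {})"
      by simp
  qed
  have "\<Union> {e \<in> triples (X \<union> Y). e \<inter> X \<noteq> {} \<and> e \<inter> Y \<noteq> {}} \<subseteq> X \<union> Y"
    using Union_triples[of "X \<union> Y"] by blast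
  from decomposable_image[OF dec[unfolded eq] f(1) this] show ?thesis
    unfolding image .
qed

lemma decomposable_crossing_base:
  assumes "finite A" "finite B" "A \<inter> B = {}" "card A = 6 \<or> card A = 9" "card B = 6 \<or> card B = 9"
  shows "decomposable (crossing_triples A B)"
proof -
  \<comment> \<open>Stated for arbitrary \<open>A\<close> and \<open>B\<close>, so that it also
    covers sizes 9 and 6 with the roles exchanged.\<close>
  have 69: "decomposable (crossing_triples A B)"
    if "finite A" "finite B" "A \<inter> B = {}" "card A = 6" "card B = 9" for A B :: "'a set"
    by (rule decomposable_crossing_transfer[OF is_decomposition_decomposable[OF crossing_6_9]
          that(1-3)]; unfold that(4,5); code_simp)
  have 66: "decomposable (crossing_triples A B)" if "card A = 6" "card B = 6"
    by (rule decomposable_crossing_transfer[OF is_decomposition_decomposable[OF crossing_6_6]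
          assms(1-3)]; unfold that; code_simp)
  have 99: "decomposable (crossing_triples A B)" if "card A = 9" "card B = 9"
    by (rule decomposable_crossing_transfer[OF is_decomposition_decomposable[OF crossing_9_9]
          assms(1-3)]; unfold that; code_simp)
  show ?thesis
    using 66 99 69[of A B] 69[of B A] assms by (auto simp: crossing_triples_commute[of A B])
qed

lemma decomposable_transversals_base:
  fixes A B C :: "'a set"
  assumes card: "card A = 3" "card B = 3" "card C = 3"
    and disj: "A \<inter> B = {}" "A \<inter> C = {}" "B \<inter> C = {}"
  shows "decomposable (transversals A B C)"
proof -
  \<comment> \<open>The residue classes mod 3 in \<open>{0..<9}\<close>, mapped onto
    \<open>A\<close>, \<open>B\<close>, \<open>C\<close> by extending an injection twice.\<close>
  define X Y Z :: "int set" where "X = {0, 3, 6}" and "Y = {1, 4, 7}" and "Z = {2, 5, 8}"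
  have fin: "finite A" "finite B" "finite C" using card by (auto intro: card_ge_0_finite)
  have XYZ: "finite X" "finite Y" "finite Z" "card X = 3" "card Y = 3" "card Z = 3"
    "X \<inter> Y = {}" "X \<inter> Z = {}" "Y \<inter> Z = {}"
    by (auto simp: X_def Y_def Z_def)
  have un: "{0..<9} = X \<union> Y \<union> Z"
    by (auto simp: X_def Y_def Z_def)
  obtain g where g: "bij_betw g X A"
    using finite_same_card_bij[of X A] XYZ fin card by auto
  obtain h where h: "inj_on h (X \<union> Y)" "\<And>U. U \<subseteq> X \<Longrightarrow> h ` U = g ` U" "h ` Y = B"
    using extend_injection[of g X Y B] g XYZ fin card disj by (auto simp: bij_betw_def)
  have hX: "h ` X = A" using h(2)[of X] g by (simp add: bij_betw_def)
  have "card Z = card C" using XYZ(6) card(3) by simp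
  moreover have "(X \<union> Y) \<inter> Z = {}" using XYZ by auto
  moreover have "h ` (X \<union> Y) \<inter> C = {}" using hX h(3) disj by (auto simp: image_Un)
  ultimately have "\<exists>f. inj_on f (X \<union> Y \<union> Z) \<and> (\<forall>U. U \<subseteq> X \<union> Y \<longrightarrow> f ` U = h ` U) \<and> f ` Z = C"
    by (rule extend_injection[OF h(1) XYZ(3) fin(3)]) blast
  then obtain f where f: "inj_on f (X \<union> Y \<union> Z)" "\<And>U. U \<subseteq> X \<union> Y \<Longrightarrow> f ` U = h ` U" "f ` Z = C"
    by blast
  have fX: "f ` X = A" and fY: "f ` Y = B" using f(2)[of X] f(2)[of Y] hX h(3) by auto
  have 1: "x mod 3 = 0 \<longleftrightarrow> x \<in> X" "x mod 3 = 1 \<longleftrightarrow> x \<in> Y" "x mod 3 = 2 \<longleftrightarrow> x \<in> Z"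
    if "x \<in> {0..<9}" for x
    using that unfolding un by (auto simp: X_def Y_def Z_def)
  have "{e \<in> triples {0..<9}. (\<exists>x\<in>e. x mod 3 = 0) \<and> (\<exists>x\<in>e. x mod 3 = 1) \<and> (\<exists>x\<in>e. x mod 3 = 2)} =
      {e \<in> triples {0..<9}. e \<inter> X \<noteq> {} \<and> e \<inter> Y \<noteq> {} \<and> e \<inter> Z \<noteq> {}}"
  proof (rule Collect_cong, rule conj_cong[OF refl])
    fix e :: "int set" assume "e \<in> triples {0..<9}"
    then have sub: "x \<in> {0..<9}" if "x \<in> e" for x using that by (auto simp: triples_def)
    have X: "(\<exists>x\<in>e. x mod 3 = 0) \<longleftrightarrow> (\<exists>x\<in>e. x \<in> X)"
      by (rule bex_cong[OF refl 1(1)[OF sub]])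
    have Y: "(\<exists>x\<in>e. x mod 3 = 1) \<longleftrightarrow> (\<exists>x\<in>e. x \<in> Y)"
      by (rule bex_cong[OF refl 1(2)[OF sub]])
    have Z: "(\<exists>x\<in>e. x mod 3 = 2) \<longleftrightarrow> (\<exists>x\<in>e. x \<in> Z)"
      by (rule bex_cong[OF refl 1(3)[OF sub]])
    show "((\<exists>x\<in>e. x mod 3 = 0) \<and> (\<exists>x\<in>e. x mod 3 = 1) \<and> (\<exists>x\<in>e. x mod 3 = 2)) =
        (e \<inter> X \<noteq> {} \<and> e \<inter> Y \<noteq> {} \<and> e \<inter> Z \<noteq> {})"
      unfolding X Y Z by blast
  qed
  then have eq: "{e \<in> triples {0..<9}. (\<exists>x\<in>e. x mod 3 = 0) \<and> (\<exists>x\<in>e. x mod 3 = 1) \<and> (\<exists>x\<in>e. x mod 3 = 2)} =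
      transversals X Y Z"
    unfolding un transversals_eq[OF XYZ(7-9)] .
  have "(`) f ` transversals X Y Z = transversals A B C"
  proof -
    have *: "transversals P Q R = (\<lambda>(x, y, z). {x, y, z}) ` (P \<times> Q \<times> R)" for P Q R :: "'b set"
      unfolding transversals_def by force
    have "(`) f ` transversals X Y Z = transversals (f ` X) (f ` Y) (f ` Z)"
      unfolding * by (force simp: image_image)
    then show ?thesis by (simp add: fX fY f(3))
  qed
  moreover have "decomposable ((`) f ` transversals X Y Z)"
    using is_decomposition_decomposable[OF transversals_3_3_3] unfolding eq
    by (rule decomposable_image[OF _ f(1)]) (auto simp: transversals_def)
  ultimately show ?thesis by simp
qed

text \<open>Each residue class mod \<open>m\<close> has exactly three members below
  \<open>3 * m\<close>, so the triples of constant residue are the classes themselves and partition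
  the vertices. This identifies the 1-factor deleted in the cyclic models.\<close>

lemma one_factor_residue_classes:
  fixes m :: int
  assumes m: "m > 0"
  shows "one_factor {0..<3 * m} {e \<in> triples {0..<3 * m}. \<forall>x\<in>e. \<forall>y\<in>e. x mod m = y mod m}"
    (is "one_factor ?V ?I")
proof -
  define R where "R = (\<lambda>x. {y \<in> ?V. y mod m = x mod m})"
  have R: "R x = {x mod m, x mod m + m, x mod m + 2 * m}" for x
  proof (intro equalityI subsetI)
    fix y assume y: "y \<in> R x"
    then have *: "y = m * (y div m) + x mod m" "0 \<le> y" "y < 3 * m"
      using mult_div_mod_eq[of m y] by (auto simp: R_def)
    have "m * (y div m) < m * 3" using *(1,3) pos_mod_sign[OF m, of x] by linarith
    then have "y div m < 3" using m by (simp add: mult_less_cancel_left_pos)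
    moreover have "0 \<le> y div m" using * m by (simp add: pos_imp_zdiv_nonneg_iff)
    ultimately have "y div m = 0 \<or> y div m = 1 \<or> y div m = 2" by auto
    then show "y \<in> {x mod m, x mod m + m, x mod m + 2 * m}"
      using *(1) by auto
  next
    fix y assume "y \<in> {x mod m, x mod m + m, x mod m + 2 * m}"
    then show "y \<in> R x"
      using m pos_mod_bound[OF m, of x] pos_mod_sign[OF m, of x] by (auto simp: R_def)
  qed
  have cR: "card (R x) = 3" for x
    using m by (simp add: R)
  have RI: "R x \<in> ?I" for x
    using cR[of x] by (auto simp: R_def triples_def)
  \<comment> \<open>A 3-subset of a 3-set is the whole set. Hence an edge is determined by any one
    of its vertices, and different edges are disjoint.\<close>
  have eqR: "e = R x" if "e \<in> ?I" "x \<in> e" for e x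
  proof (rule card_subset_eq)
    show "finite (R x)" by (simp add: R)
    show "e \<subseteq> R x" using that unfolding R_def triples_def by blast
    have "card e = 3" using that(1) unfolding triples_def by blast
    then show "card e = card (R x)" by (simp only: cR)
  qed
  show ?thesis
    unfolding one_factor_def
  proof (intro conjI ballI impI)
    show "?I \<subseteq> triples ?V" by auto
    show "\<Union> ?I = ?V"
    proof
      show "\<Union> ?I \<subseteq> ?V" by (auto simp: triples_def)
      show "?V \<subseteq> \<Union> ?I"
      proof
        fix x assume "x \<in> ?V"
        then have "x \<in> R x" by (simp add: R_def)
        then show "x \<in> \<Union> ?I" using RI[of x] by blast
      qed
    qed
    fix e f assume "e \<in> ?I" "f \<in> ?I" "e \<noteq> f"
    then show "e \<inter> f = {}" using eqR by blast
  qed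
qed

lemma decomposable_complete_transfer:
  fixes m :: int and V :: "'a set"
  assumes dec: "decomposable {e \<in> triples {0..<3 * m}. \<exists>x\<in>e. \<exists>y\<in>e. x mod m \<noteq> y mod m}"
    and m: "m > 0" and fin: "finite V" and card: "int (card V) = 3 * m"
  shows "\<exists>I. one_factor V I \<and> decomposable (triples V - I)"
proof -
  let ?S = "{0..<3 * m}"
  let ?I = "{e \<in> triples ?S. \<forall>x\<in>e. \<forall>y\<in>e. x mod m = y mod m}"
  have "card ?S = card V" using card by (metis card_atLeastLessThan_int diff_zero nat_int)
  then obtain f where f: "bij_betw f ?S V"
    using finite_same_card_bij[of ?S V] fin by auto
  then have inj: "inj_on f ?S" and im: "f ` ?S = V" by (auto simp: bij_betw_def)
  have dec': "decomposable (triples ?S - ?I)"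
    using dec by (rule back_subst[of decomposable]) auto
  have "inj_on ((`) f) (triples ?S)"
    by (rule inj_on_image) (rule inj_on_subset[OF inj Union_triples])
  then have image: "(`) f ` (triples ?S - ?I) = triples V - (`) f ` ?I"
    unfolding im[symmetric] image_triples[OF inj, symmetric]
    by (rule inj_on_image_set_diff) auto
  have "decomposable ((`) f ` (triples ?S - ?I))"
    using dec' by (rule decomposable_image[OF _ inj]) (auto simp: triples_def)
  moreover have "one_factor V ((`) f ` ?I)"
    using one_factor_image[OF one_factor_residue_classes[OF m] inj] by (simp add: im)
  ultimately show ?thesis unfolding image by blast
qed

lemma decomposable_complete_base:
  assumes "finite V" "card V = 9 \<or> card V = 12 \<or> card V = 15"
  shows "\<exists>I. one_factor V I \<and> decomposable (triples V - I)"
  using assms(2)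
proof (elim disjE)
  assume "card V = 9"
  then show ?thesis
    using decomposable_complete_transfer[of 3 V] assms(1)
      is_decomposition_decomposable[OF complete_minus_factor_9] by simp
next
  assume "card V = 12"
  then show ?thesis
    using decomposable_complete_transfer[of 4 V] assms(1)
      is_decomposition_decomposable[OF complete_minus_factor_12] by simp
next
  assume "card V = 15"
  then show ?thesis
    using decomposable_complete_transfer[of 5 V] assms(1)
      is_decomposition_decomposable[OF complete_minus_factor_15] by simp
qed

section \<open>Splitting\<close>

lemma split_card:
  assumes "finite V" "k \<le> card V"
  obtains A B where "V = A \<union> B" "A \<inter> B = {}" "finite A" "finite B" "card A = k" "card B = card V - k"
proof -
  obtain A where A: "A \<subseteq> V" "card A = k" "finite A"
    using obtain_subset_with_card_n[OF assms(2)] by blast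
  have "V = A \<union> (V - A)" "A \<inter> (V - A) = {}" "finite (V - A)" "card (V - A) = card V - k"
    using A assms by (auto simp: card_Diff_subset)
  then show ?thesis using that A by blast
qed

text \<open>Three vertices at a time are cut off the third part while the other two stay fixed;
  transversals through different pieces are disjoint.\<close>

lemma decomposable_transversals_extend:
  assumes base: "\<And>D. D \<subseteq> C \<Longrightarrow> card D = 3 \<Longrightarrow> decomposable (transversals A B D)"
    and "finite C" "3 dvd card C" "A \<inter> C = {}" "B \<inter> C = {}"
  shows "decomposable (transversals A B C)"
  using assms
proof (induction "card C" arbitrary: C rule: less_induct)
  case less
  show ?case
  proof (cases "card C = 0")
    case True
    then have "transversals A B C = {}" using less.prems by (simp add: transversals_def)
    then show ?thesis by (simp add: decomposable_empty)
  next
    case False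
    then have "3 \<le> card C" using less.prems(3) by (auto intro: dvd_imp_le)
    from split_card[OF less.prems(2) this]
    obtain D E where D: "C = D \<union> E" "D \<inter> E = {}" "finite D" "finite E" "card D = 3" "card E = card C - 3" .
    have "decomposable (transversals A B D)" using less.prems(1) D by blast
    moreover have "decomposable (transversals A B E)"
    proof (rule less.hyps)
      show "card E < card C" using D \<open>3 \<le> card C\<close> by simp
      show "decomposable (transversals A B F)" if "F \<subseteq> E" "card F = 3" for F
        using less.prems(1) that D by blast
    qed (use less.prems D in auto)
    moreover have "transversals A B D \<inter> transversals A B E = {}"
    proof -
      have "e \<inter> D \<noteq> {}" if "e \<in> transversals A B D" for e
        using that by (auto simp: transversals_def)
      moreover have "e \<inter> D = {}" if "e \<in> transversals A B E" for e
        using that D(1,2) less.prems(4,5) by (auto simp: transversals_def)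
      ultimately show ?thesis by blast
    qed
    moreover have "transversals A B C = transversals A B D \<union> transversals A B E"
      unfolding D(1) transversals_def by blast
    ultimately show ?thesis by (simp add: decomposable_Un)
  qed
qed

text \<open>Starting from three 3-sets, the parts are enlarged one after another: \<open>C\<close>
  in fact \<open>1\<close>, \<open>B\<close> in fact \<open>2\<close>, then \<open>A\<close>.
  Rotation brings the growing part into third place.\<close>

lemma decomposable_transversals:
  assumes "finite A" "finite B" "finite C" "3 dvd card A" "3 dvd card B" "3 dvd card C"
    and "A \<inter> B = {}" "A \<inter> C = {}" "B \<inter> C = {}"
  shows "decomposable (transversals A B C)"
proof -
  have 1: "decomposable (transversals A' B' C)" if "A' \<subseteq> A" "card A' = 3" "B' \<subseteq> B" "card B' = 3" for A' B'
    by (rule decomposable_transversals_extend, rule decomposable_transversals_base)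
      (use assms that in auto)
  have 2: "decomposable (transversals A' B C)" if "A' \<subseteq> A" "card A' = 3" for A'
    unfolding transversals_rotate[of C A' B, symmetric]
    by (rule decomposable_transversals_extend, unfold transversals_rotate[of C A'], rule 1)
      (use assms that in auto)
  show ?thesis
    unfolding transversals_rotate[of A B C]
    by (rule decomposable_transversals_extend, unfold transversals_rotate[of _ B C, symmetric], rule 2)
      (use assms in auto)
qed

lemma decomposable_crossing_extend:
  assumes base: "\<And>D. D \<subseteq> B \<Longrightarrow> card D = 6 \<or> card D = 9 \<Longrightarrow> decomposable (crossing_triples A D)"
    and "finite A" "finite B" "A \<inter> B = {}" "3 dvd card A" "3 dvd card B" "6 \<le> card B"
  shows "decomposable (crossing_triples A B)"
  using assms
proof (induction "card B" arbitrary: B rule: less_induct)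
  case less
  show ?case
  proof (cases "card B = 6 \<or> card B = 9")
    case True
    then show ?thesis using less.prems(1) by blast
  next
    case False
    \<comment> \<open>The multiples of 3 from 6 on, other than 6 and 9, are at least 12. So cutting
      off 6 vertices leaves at least 6, again a multiple of 3.\<close>
    then have big: "12 \<le> card B" using less.prems(6,7) by presburger
    then have "6 \<le> card B" by simp
    from split_card[OF less.prems(3) this]
    obtain D E where D: "B = D \<union> E" "D \<inter> E = {}" "finite D" "finite E" "card D = 6" "card E = card B - 6" .
    have E: "3 dvd card E" using D(6) less.prems(6) big by presburger
    have "decomposable (crossing_triples A D)" using less.prems(1) D by blast
    moreover have "decomposable (crossing_triples A E)"
    proof (rule less.hyps)
      show "card E < card B" "6 \<le> card E" using D big by simp_all
      show "decomposable (crossing_triples A F)" if "F \<subseteq> E" "card F = 6 \<or> card F = 9" for F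
        using less.prems(1) that D by blast
    qed (use less.prems D E in auto)
    moreover have "decomposable (transversals A D E)"
      using less.prems D E by (intro decomposable_transversals) auto
    ultimately show ?thesis
      unfolding D(1) using less.prems(4) D by (intro decomposable_crossing_Un) auto
  qed
qed

text \<open>The extension is applied on both sides: first \<open>B\<close> grows against a piece of
  \<open>A\<close> of size 6 or 9, then \<open>A\<close> grows against all of
  \<open>B\<close>.\<close>

lemma decomposable_crossing:
  assumes "finite A" "finite B" "A \<inter> B = {}" "3 dvd card A" "3 dvd card B" "6 \<le> card A" "6 \<le> card B"
  shows "decomposable (crossing_triples A B)"
proof -
  have base: "decomposable (crossing_triples B D)" if D: "D \<subseteq> A" "card D = 6 \<or> card D = 9" for D
    unfolding crossing_triples_commute[of B D]
  proof (rule decomposable_crossing_extend)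
    show "decomposable (crossing_triples D E)" if "E \<subseteq> B" "card E = 6 \<or> card E = 9" for E
      using assms D that by (intro decomposable_crossing_base) (auto intro: finite_subset)
    show "3 dvd card D" using D(2) by auto
  qed (use assms D in \<open>auto intro: finite_subset\<close>)
  show ?thesis
    unfolding crossing_triples_commute[of A B]
    by (rule decomposable_crossing_extend[OF base]) (use assms in auto)
qed

lemma decomposable_complete_minus_factor:
  assumes "finite V" "3 dvd card V" "9 \<le> card V"
  shows "\<exists>I. one_factor V I \<and> decomposable (triples V - I)"
  using assms
proof (induction "card V" arbitrary: V rule: less_induct)
  case less
  show ?case
  proof (cases "card V = 9 \<or> card V = 12 \<or> card V = 15")
    case True
    then show ?thesis using less.prems(1) by (intro decomposable_complete_base) auto
  next
    case False
    \<comment> \<open>With 9, 12 and 15 excluded, cutting off 9 vertices leaves at least 9. The rest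
      is thus large enough for the induction and for the crossing triples.\<close>
    then have big: "18 \<le> card V" using less.prems(2,3) by presburger
    from split_card[OF less.prems(1,3)]
    obtain A B where AB: "V = A \<union> B" "A \<inter> B = {}" "finite A" "finite B" "card A = 9" "card B = card V - 9" .
    have B: "3 dvd card B" using AB(6) less.prems(2) big by presburger
    obtain I where I: "one_factor A I" "decomposable (triples A - I)"
      using decomposable_complete_base[of A] AB by auto
    have "card B < card V" "9 \<le> card B" using AB(6) big by simp_all
    then obtain J where J: "one_factor B J" "decomposable (triples B - J)"
      using less.hyps[of B] AB(4) B by blast
    have sub: "I \<subseteq> triples A" "J \<subseteq> triples B" using I(1) J(1) by (auto simp: one_factor_def)
    have disj: "triples A \<inter> triples B = {}"
      using AB(2) by (auto simp: triples_def) (metis Int_greatest card.empty subset_empty zero_neq_numeral)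
    have "crossing_triples A B \<inter> (triples A \<union> triples B) = {}"
      using AB(2) unfolding crossing_triples_def triples_def by blast
    moreover have "triples V = triples A \<union> triples B \<union> crossing_triples A B"
      unfolding AB(1) crossing_triples_def triples_def by blast
    \<comment> \<open>Each 1-factor lies inside its own part, so deleting both leaves all crossing
      triples in place.\<close>
    ultimately have "triples V - (I \<union> J) = (triples A - I) \<union> (triples B - J) \<union> crossing_triples A B"
      using sub disj by blast
    moreover have "decomposable ((triples A - I) \<union> (triples B - J) \<union> crossing_triples A B)"
    proof (intro decomposable_Un I J)
      show "decomposable (crossing_triples A B)"
        using AB(2-5) B \<open>9 \<le> card B\<close> by (intro decomposable_crossing) auto
    qed (use disj \<open>crossing_triples A B \<inter> (triples A \<union> triples B) = {}\<close> in blast)+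
    moreover have "one_factor V (I \<union> J)"
      using one_factor_Un[OF I(1) J(1) AB(2)] AB(1) by simp
    ultimately show ?thesis by (intro exI[of _ "I \<union> J"]) simp
  qed
qed

theorem theorem14:
  fixes v :: nat
  assumes "v mod 6 = 0" and "v \<ge> 18"
  shows "\<exists>I. one_factor {..<v} I \<and> two_split_decomposition 9 {..<v} I"
proof -
  \<comment> \<open>The size of one half; both halves then satisfy the divisibility and size
    conditions of the two decomposition lemmas.\<close>
  obtain w where w: "v = 2 * w" "3 dvd w" "9 \<le> w"
  proof
    show "v = 2 * (v div 2)" "3 dvd v div 2" "9 \<le> v div 2" using assms by presburger+
  qed
  have "w \<le> card {..<v}" using w by simp
  from split_card[OF finite_lessThan this]
  obtain A B where AB: "{..<v} = A \<union> B" "A \<inter> B = {}" "finite A" "finite B" "card A = w"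
    "card B = card {..<v} - w" .
  have B: "card B = w" using AB(6) w by simp
  obtain I C1 where I: "one_factor A I" "cycle_decomposition 9 (triples A - I) C1"
    using decomposable_complete_minus_factor[of A] AB(3,5) w unfolding decomposable_def by auto
  obtain J C2 where J: "one_factor B J" "cycle_decomposition 9 (triples B - J) C2"
    using decomposable_complete_minus_factor[of B] AB(4) B w unfolding decomposable_def by auto
  obtain C3 where C3: "cycle_decomposition 9 (crossing_triples A B) C3"
    using decomposable_crossing[of A B] AB(2-5) B w unfolding decomposable_def by auto
  have "two_split_decomposition 9 {..<v} (I \<union> J)"
    unfolding two_split_decomposition_def
  proof (intro exI conjI)
    show "A \<union> B = {..<v}" "A \<inter> B = {}" using AB(1,2) by simp_all
    show "2 * card A = card {..<v}" "2 * card B = card {..<v}" using AB(5) B w(1) by simp_all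
  qed (rule I J C3 refl)+
  moreover have "one_factor {..<v} (I \<union> J)"
    using one_factor_Un[OF I(1) J(1) AB(2)] AB(1) by simp
  ultimately show ?thesis by blast
qed

end
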